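(* Let $\mu$ be the Cantor-Lebesgue measure on the middle-thirds Cantor set. Then for every $C^2$ function $F:\mathbb{R}\to\mathbb{R}$ such that $F''>0$ there exists a constant $C_F>0$ such that \[ |\widehat{F\mu}(u)|\le C_F|u|^{-\sigma}\qquad\text{for all } u\in\mathbb{R}\setminus\{0\}. \] Moreover, one can take $\sigma=0.016$.
   Context: The Cantor-Lebesgue measure is, up to an affine change of coordinates, the distribution of the random sum $\sum_{n=1}^\infty\pm 3^{-n}$, where the signs are independent and identically distributed with equal probabilities. $F\mu$ denotes the push-forward measure $F\mu(A)=\mu(F^{-1}A)$ for Borel sets $A\subset\mathbb{R}$, and the Fourier transform of a finite Borel measure $\mu$ on $\mathbb{R}$ is $\widehat{\mu}(\xi)=\int e^{2\pi i\xi x}\,d\mu(x)$. *)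

theory Defs
  imports "HOL-Probability.Probability"
begin

text \<open>
  The random sum takes values in the Cantor set translated to \<open>[-1/2, 1/2]\<close>; adding \<open>1/2\<close> moves it
  to the standard middle-thirds Cantor set in \<open>[0, 1]\<close>. The signs are indexed from \<open>0\<close>, so the sign
  \<open>\<omega> n\<close> has weight \<open>3\<close> to the power \<open>-(n + 1)\<close>.
\<close>

definition coin_signs :: "(nat \<Rightarrow> real) measure" where
  "coin_signs = (\<Pi>\<^sub>M n\<in>UNIV. measure_pmf (pmf_of_set {-1, 1}))"

definition cantor_lebesgue :: "real measure" where
  "cantor_lebesgue = distr coin_signs borel (\<lambda>\<omega>. 1 / 2 + (\<Sum>n. \<omega> n * (1 / 3) ^ Suc n))"

text \<open>
  The normalisation differs from that of the library's characteristic function \<^const>\<open>char\<close> by the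
  factor \<open>2 * pi\<close>.
\<close>

definition fourier_transform :: "real measure \<Rightarrow> real \<Rightarrow> complex" where
  "fourier_transform \<mu> \<xi> = (\<integral>x. exp (2 * of_real pi * \<i> * of_real \<xi> * of_real x) \<partial>\<mu>)"

lemma fourier_transform_eq_char: "fourier_transform \<mu> \<xi> = char \<mu> (2 * pi * \<xi>)"
  by (simp add: fourier_transform_def char_def mult_ac)

lemma prob_space_coin_signs: "prob_space coin_signs"
  unfolding coin_signs_def by (intro prob_space_PiM measure_pmf.prob_space_axioms)

lemma measurable_coin_sum:
  "(\<lambda>\<omega>. 1 / 2 + (\<Sum>n. \<omega> n * (1 / 3) ^ Suc n)) \<in> borel_measurable coin_signs"
proof -
  have [measurable]: "(\<lambda>\<omega>. \<omega> n) \<in> borel_measurable coin_signs" for n :: nat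
    unfolding coin_signs_def
    by (rule measurable_compose[OF measurable_component_singleton]) auto
  show ?thesis
    by measurable
qed

lemma sets_cantor_lebesgue [simp, measurable_cong]: "sets cantor_lebesgue = sets borel"
  by (simp add: cantor_lebesgue_def)

lemma prob_space_cantor_lebesgue: "prob_space cantor_lebesgue"
  unfolding cantor_lebesgue_def
  by (intro prob_space.prob_space_distr prob_space_coin_signs measurable_coin_sum)

end

theory Submission
  imports Defs
begin

text \<open>
  Write \<open>\<mu>\<close> for the Cantor-Lebesgue measure and \<open>\<phi>\<close> for its Fourier transform. The measure is the
  average of its \<open>2 ^ n\<close> copies scaled by \<open>3 ^ (-n)\<close>, whose left end points are \<open>k / 3 ^ n\<close> with the
  base-3 digits of \<open>k\<close> in \<open>{0, 2}\<close> (\<open>integral_cantor_lebesgue_pieces\<close>). On one copy \<open>F\<close> is affine up to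
  an error of order \<open>9 ^ (-n)\<close>, so this copy contributes to the transform of the image measure, up to a
  unimodular factor and an error of order \<open>\<bar>u\<bar> * 9 ^ (-n)\<close>, the number \<open>\<phi> (\<eta> k)\<close> at the frequency
  \<open>\<eta> k = u * F' (k / 3 ^ n) / 3 ^ n\<close> (\<open>norm_piece_le\<close>).

  Convexity enters here: since \<open>F''\<close> is bounded below by some \<open>b > 0\<close> on \<open>[0, 1]\<close>, distinct \<open>k\<close> have
  frequencies at distance at least \<open>c = b * \<bar>u\<bar> / 9 ^ n\<close>, while all of them lie in an interval of length
  of order \<open>3 ^ n\<close>. For such a family a discrete \<open>L\<^sup>2\<close> estimate (\<open>sum_sq_fourier_cantor_le\<close>) gives
  \<open>\<Sum>k. \<bar>\<phi> (\<eta> k)\<bar>\<^sup>2 \<le> const * (1 + 1 / c) * (8 / 5) ^ n\<close>. It comes from the product formula for \<open>\<phi>\<close>, whose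
  factors are \<open>cos (2 * pi * \<xi> / 3 ^ j)\<close>, and from the fact that \<open>cos\<^sup>2\<close> has mean \<open>1 / 2\<close> over three
  equally spaced angles: adding one ternary digit to the frequency multiplies the sum by \<open>3 / 2\<close>. The
  growth rate \<open>8 / 5\<close> instead of \<open>3 / 2\<close> pays for comparing each frequency with a nearby point of a
  grid of step \<open>1\<close>.

  The growth rate is smaller than the number \<open>2\<close> of copies per step, so by the Cauchy-Schwarz inequality
  the mean of \<open>\<bar>\<phi> (\<eta> k)\<bar>\<close> over the \<open>2 ^ n\<close> copies is at most of order \<open>sqrt ((1 + 1 / c) * (4 / 5) ^ n)\<close>.
  Choosing \<open>n\<close> with \<open>\<bar>u\<bar>\<close> comparable to \<open>3 ^ (1.9 * n)\<close> makes both this mean and the linearisation error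
  at most of order \<open>3 ^ (-n / 20)\<close>, which is a power of \<open>\<bar>u\<bar>\<close> with exponent about \<open>-0.026\<close>
  (\<open>power_decay_from_scales\<close>).
\<close>

section \<open>Self-similarity of the Cantor-Lebesgue measure\<close>

lemma coin_signs_AE: "AE \<omega> in coin_signs. \<forall>n. \<omega> n \<in> {-1, 1}"
proof -
  have "AE \<omega> in coin_signs. \<omega> n \<in> {-1, 1}" for n
    unfolding coin_signs_def
    by (rule AE_PiM_component)
      (auto simp: AE_measure_pmf_iff set_pmf_of_set intro: measure_pmf.prob_space_axioms)
  then show ?thesis
    by (simp add: AE_all_countable)
qed

lemma
  fixes \<omega> :: "nat \<Rightarrow> real"
  assumes "\<forall>n. \<omega> n \<in> {-1, 1}"
  shows summable_coin_sum: "summable (\<lambda>n. \<omega> n * (1 / 3) ^ Suc n)"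
    and abs_coin_sum_le: "\<bar>\<Sum>n. \<omega> n * (1 / 3) ^ Suc n\<bar> \<le> 1 / 2"
proof -
  have geom: "(\<lambda>n. (1 / 3) ^ Suc n) sums (1 / 2 :: real)"
    using sums_mult[OF geometric_sums[of "1 / 3 :: real"], of "1 / 3"] by simp
  have norm: "norm (\<omega> n * (1 / 3) ^ Suc n) \<le> (1 / 3) ^ Suc n" for n
    using assms[rule_format, of n] by (auto simp: abs_mult)
  show "summable (\<lambda>n. \<omega> n * (1 / 3) ^ Suc n)"
    by (rule summable_comparison_test'[OF sums_summable[OF geom] norm])
  show "\<bar>\<Sum>n. \<omega> n * (1 / 3) ^ Suc n\<bar> \<le> 1 / 2"
    using norm_suminf_le[OF norm sums_summable[OF geom]] sums_unique[OF geom] by simp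
qed

lemma cantor_lebesgue_AE: "AE x in cantor_lebesgue. x \<in> {0..1}"
proof -
  have "AE \<omega> in coin_signs. 1 / 2 + (\<Sum>n. \<omega> n * (1 / 3) ^ Suc n) \<in> {0..1}"
    using coin_signs_AE
  proof eventually_elim
    case (elim \<omega>)
    from abs_coin_sum_le[OF elim] show ?case unfolding atLeastAtMost_iff by linarith
  qed
  then show ?thesis
    unfolding cantor_lebesgue_def by (subst AE_distr_iff[OF measurable_coin_sum]) auto
qed

lemma integrable_cantor_lebesgue:
  fixes f :: "real \<Rightarrow> complex"
  assumes "f \<in> borel_measurable borel" and "\<And>x. norm (f x) \<le> B"
  shows "integrable cantor_lebesgue f"
proof -
  interpret prob_space cantor_lebesgue by (rule prob_space_cantor_lebesgue)
  have [measurable]: "f \<in> borel_measurable borel" by fact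
  show ?thesis by (rule integrable_const_bound[of _ B]) (use assms in auto)
qed

text \<open>
  Splitting off the first sign leaves a sequence of signs with the same law, and shifting the series
  by one place divides it by \<open>3\<close>.
\<close>

lemma integral_cantor_lebesgue_self_similar:
  fixes f :: "real \<Rightarrow> complex"
  assumes f: "f \<in> borel_measurable borel" and bound: "\<And>x. norm (f x) \<le> B"
  shows "(\<integral>x. f x \<partial>cantor_lebesgue) =
    ((\<integral>x. f (x / 3) \<partial>cantor_lebesgue) + (\<integral>x. f ((x + 2) / 3) \<partial>cantor_lebesgue)) / 2"
proof -
  define X :: "(nat \<Rightarrow> real) \<Rightarrow> real"
    where "X \<omega> = 1 / 2 + (\<Sum>n. \<omega> n * (1 / 3) ^ Suc n)" for \<omega>
  let ?M = "measure_pmf (pmf_of_set {-1, 1 :: real})"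
  interpret seq: sequence_space ?M
    by (simp add: sequence_space_def product_prob_spaceI measure_pmf.prob_space_axioms)
  interpret C: prob_space coin_signs by (rule prob_space_coin_signs)
  interpret pair: pair_prob_space ?M coin_signs ..
  have X [measurable]: "X \<in> borel_measurable coin_signs"
    unfolding X_def by (rule measurable_coin_sum)
  note [measurable] = f
  have glue [measurable]:
    "(\<lambda>p. case_nat (fst p) (snd p)) \<in> measurable (?M \<Otimes>\<^sub>M coin_signs) coin_signs"
    unfolding coin_signs_def by measurable
  have iter: "distr (?M \<Otimes>\<^sub>M coin_signs) coin_signs (\<lambda>p. case_nat (fst p) (snd p)) = coin_signs"
    using seq.PiM_iter unfolding coin_signs_def by (simp add: case_prod_beta')
  have law: "(\<integral>x. g x \<partial>cantor_lebesgue) = (\<integral>\<omega>. g (X \<omega>) \<partial>coin_signs)"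
    if "g \<in> borel_measurable borel" for g :: "real \<Rightarrow> complex"
    unfolding cantor_lebesgue_def X_def by (rule integral_distr[OF measurable_coin_sum that])
  have X_case: "AE \<omega> in coin_signs. X (case_nat s \<omega>) = (X \<omega> + 1 + s) / 3"
    if s: "s \<in> {-1, 1}" for s
    using coin_signs_AE
  proof eventually_elim
    case (elim \<omega>)
    have signs: "\<forall>n. case_nat s \<omega> n \<in> {-1, 1}"
      using elim s by (auto split: nat.split)
    have "(\<Sum>n. case_nat s \<omega> n * (1 / 3) ^ Suc n)
        = s / 3 + (\<Sum>n. 1 / 3 * (\<omega> n * (1 / 3) ^ Suc n))"
      using suminf_split_head[OF summable_coin_sum[OF signs]] by (simp add: mult_ac)
    also have "\<dots> = s / 3 + 1 / 3 * (\<Sum>n. \<omega> n * (1 / 3) ^ Suc n)"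
      by (subst suminf_mult[OF summable_coin_sum[OF elim]]) simp
    finally show ?case
      unfolding X_def by (simp add: field_simps)
  qed
  have branch: "(\<integral>\<omega>. f (X (case_nat s \<omega>)) \<partial>coin_signs)
      = (\<integral>x. f ((x + 1 + s) / 3) \<partial>cantor_lebesgue)" if s: "s \<in> {-1, 1}" for s
  proof -
    have [measurable]: "(\<lambda>\<omega>. case_nat s \<omega>) \<in> measurable coin_signs coin_signs"
      unfolding coin_signs_def by (intro measurable_case_nat') auto
    have "(\<integral>\<omega>. f (X (case_nat s \<omega>)) \<partial>coin_signs) = (\<integral>\<omega>. f ((X \<omega> + 1 + s) / 3) \<partial>coin_signs)"
    proof (rule integral_cong_AE)
      show "AE \<omega> in coin_signs. f (X (case_nat s \<omega>)) = f ((X \<omega> + 1 + s) / 3)"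
        using X_case[OF s] by eventually_elim (simp only:)
    qed measurable
    then show ?thesis by (subst law) auto
  qed
  have int: "integrable (?M \<Otimes>\<^sub>M coin_signs) (\<lambda>p. f (X (case_nat (fst p) (snd p))))"
    by (rule pair.integrable_const_bound[of _ B]) (use bound in auto)
  have "(\<integral>x. f x \<partial>cantor_lebesgue) = (\<integral>\<omega>. f (X \<omega>) \<partial>coin_signs)"
    by (rule law[OF f])
  also have "\<dots> = (\<integral>p. f (X (case_nat (fst p) (snd p))) \<partial>(?M \<Otimes>\<^sub>M coin_signs))"
    by (subst iter[symmetric], subst integral_distr) auto
  also have "\<dots> = (\<integral>s. (\<integral>\<omega>. f (X (case_nat s \<omega>)) \<partial>coin_signs) \<partial>?M)"
    using pair.integral_fst'[OF int] by simp
  also have "\<dots> = (\<Sum>s\<in>{-1, 1}. (\<integral>\<omega>. f (X (case_nat s \<omega>)) \<partial>coin_signs)) / 2"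
    by (subst integral_measure_pmf[of "{-1, 1}"])
      (auto simp: set_pmf_of_set indicator_def scaleR_conv_of_real add_divide_distrib)
  finally show ?thesis
    using branch[of "-1"] branch[of 1] by (simp add: add.assoc)
qed

text \<open>
  The numbers below \<open>3 ^ n\<close> all of whose base-3 digits are \<open>0\<close> or \<open>2\<close>; the left end points of the
  intervals of generation \<open>n\<close> in the construction of the Cantor set are these numbers over \<open>3 ^ n\<close>.
\<close>

primrec cantor_numerators :: "nat \<Rightarrow> nat set" where
  "cantor_numerators 0 = {0}"
| "cantor_numerators (Suc n) =
    (\<lambda>k. 3 * k) ` cantor_numerators n \<union> (\<lambda>k. 3 * k + 2) ` cantor_numerators n"

lemma finite_cantor_numerators: "finite (cantor_numerators n)"
  by (induction n) auto

lemma cantor_numerators_less: "k \<in> cantor_numerators n \<Longrightarrow> k < 3 ^ n"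
proof (induction n arbitrary: k)
  case (Suc n)
  then obtain j where "j < 3 ^ n" "k = 3 * j \<or> k = 3 * j + 2" by auto
  then show ?case by auto
qed simp

lemma sum_cantor_numerators_Suc:
  "sum g (cantor_numerators (Suc n)) = (\<Sum>k\<in>cantor_numerators n. g (3 * k) + g (3 * k + 2))"
proof -
  have "(\<lambda>k. 3 * k) ` A \<inter> (\<lambda>k. 3 * k + 2) ` A = {}" for A :: "nat set"
    by (auto, presburger)
  then show ?thesis
    unfolding cantor_numerators.simps
    by (subst sum.union_disjoint)
      (auto simp: finite_cantor_numerators sum.reindex inj_on_def sum.distrib)
qed

lemma card_cantor_numerators: "card (cantor_numerators n) = 2 ^ n"
  by (induction n)
    (simp_all add: card_eq_sum sum_cantor_numerators_Suc
      del: cantor_numerators.simps(2) sum_constant flip: sum_distrib_right mult_2,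
     simp_all)

lemma integral_cantor_lebesgue_pieces:
  fixes f :: "real \<Rightarrow> complex"
  assumes f: "f \<in> borel_measurable borel" and bound: "\<And>x. norm (f x) \<le> B"
  shows "(\<integral>x. f x \<partial>cantor_lebesgue) =
    (\<Sum>k\<in>cantor_numerators n. \<integral>x. f ((real k + x) / 3 ^ n) \<partial>cantor_lebesgue) / 2 ^ n"
proof (induction n)
  case (Suc n)
  note [measurable] = f
  have split: "(\<integral>x. f ((real k + x) / 3 ^ n) \<partial>cantor_lebesgue) =
      ((\<integral>x. f ((real (3 * k) + x) / 3 ^ Suc n) \<partial>cantor_lebesgue)
        + (\<integral>x. f ((real (3 * k + 2) + x) / 3 ^ Suc n) \<partial>cantor_lebesgue)) / 2" for k
    by (subst integral_cantor_lebesgue_self_similar[where B = B])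
      (simp_all add: bound field_simps)
  then show ?case
    unfolding Suc.IH sum_cantor_numerators_Suc split by (simp add: sum_divide_distrib)
qed simp

section \<open>The Fourier transform of the Cantor-Lebesgue measure\<close>

lemma fourier_transform_eq_cis: "fourier_transform \<mu> \<xi> = (\<integral>x. cis (2 * pi * \<xi> * x) \<partial>\<mu>)"
  unfolding fourier_transform_def by (simp add: cis_conv_exp mult_ac)

lemma borel_measurable_cis: "g \<in> borel_measurable M \<Longrightarrow> (\<lambda>x. cis (g x)) \<in> borel_measurable M"
  by (rule borel_measurable_continuous_on) (auto intro!: continuous_intros)

lemma norm_cis_diff_le: "norm (cis a - cis b) \<le> \<bar>a - b\<bar>"
proof -
  have "norm (cis a - cis b) = norm (cis b * (cis (a - b) - 1))"
    by (simp add: right_diff_distrib cis_mult)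
  also have "\<dots> = norm (cis (a - b) - 1)"
    by (simp add: norm_mult)
  also have "\<dots> \<le> \<bar>a - b\<bar>"
    using iexp_approx1[of "a - b" 0] by (simp add: cis_conv_exp)
  finally show ?thesis .
qed

lemma norm_fourier_transform_le_1:
  assumes "prob_space \<mu>"
  shows "norm (fourier_transform \<mu> \<xi>) \<le> 1"
proof -
  interpret prob_space \<mu> by fact
  have "norm (fourier_transform \<mu> \<xi>) \<le> (\<integral>x. norm (cis (2 * pi * \<xi> * x)) \<partial>\<mu>)"
    unfolding fourier_transform_eq_cis by (rule integral_norm_bound)
  then show ?thesis by (simp add: prob_space)
qed

lemma norm_one_plus_cis: "norm (1 + cis (2 * t)) = 2 * \<bar>cos t\<bar>"
proof -
  have "1 + cis (2 * t) = cis t * (2 * of_real (cos t))"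
    by (simp add: complex_eq_iff cos_double_cos sin_double power2_eq_square)
  then show ?thesis by (simp add: norm_mult)
qed

text \<open>
  The two copies in the self-similarity relation differ by a translation by \<open>2 / 3\<close>, so their
  transforms differ by a phase, and the mean of \<open>1\<close> and this phase has modulus \<open>\<bar>cos\<bar>\<close>.
\<close>

lemma norm_fourier_cantor_step:
  "norm (fourier_transform cantor_lebesgue \<xi>) =
    \<bar>cos (2 * pi * \<xi> / 3)\<bar> * norm (fourier_transform cantor_lebesgue (\<xi> / 3))"
proof -
  have "fourier_transform cantor_lebesgue \<xi> =
      ((\<integral>x. cis (2 * pi * \<xi> * (x / 3)) \<partial>cantor_lebesgue)
        + (\<integral>x. cis (2 * pi * \<xi> * ((x + 2) / 3)) \<partial>cantor_lebesgue)) / 2"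
    unfolding fourier_transform_eq_cis
    by (rule integral_cantor_lebesgue_self_similar[where B = 1])
      (auto intro!: borel_measurable_cis)
  also have "(\<integral>x. cis (2 * pi * \<xi> * ((x + 2) / 3)) \<partial>cantor_lebesgue)
      = (\<integral>x. cis (2 * (2 * pi * \<xi> / 3)) * cis (2 * pi * \<xi> * (x / 3)) \<partial>cantor_lebesgue)"
    by (simp add: cis_mult algebra_simps add_divide_distrib)
  also have "\<dots> = cis (2 * (2 * pi * \<xi> / 3)) * fourier_transform cantor_lebesgue (\<xi> / 3)"
    by (simp add: fourier_transform_eq_cis)
  also have "(\<integral>x. cis (2 * pi * \<xi> * (x / 3)) \<partial>cantor_lebesgue)
      = fourier_transform cantor_lebesgue (\<xi> / 3)"
    by (simp add: fourier_transform_eq_cis)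
  finally have "fourier_transform cantor_lebesgue \<xi> =
      (1 + cis (2 * (2 * pi * \<xi> / 3))) * fourier_transform cantor_lebesgue (\<xi> / 3) / 2"
    by (simp add: algebra_simps)
  then show ?thesis
    by (simp only: norm_mult norm_divide norm_one_plus_cis) simp
qed

text \<open>
  The \<open>q\<close> factors of largest frequency are bounded by \<open>1\<close>; each of the remaining ones changes little
  when \<open>\<xi>\<close> moves by at most \<open>1\<close>.
\<close>

lemma norm_fourier_cantor_le_prod:
  "(norm (fourier_transform cantor_lebesgue \<xi>))\<^sup>2 \<le> (\<Prod>j<m. (cos (2 * pi * \<xi> / 3 ^ (q + j + 1)))\<^sup>2)"
proof (induction q arbitrary: \<xi>)
  case 0
  show ?case
  proof (induction m arbitrary: \<xi>)
    case 0
    show ?case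
      using norm_fourier_transform_le_1[OF prob_space_cantor_lebesgue, of \<xi>]
      by (simp add: power_le_one)
  next
    case (Suc m)
    have "(norm (fourier_transform cantor_lebesgue \<xi>))\<^sup>2
        = (cos (2 * pi * \<xi> / 3))\<^sup>2 * (norm (fourier_transform cantor_lebesgue (\<xi> / 3)))\<^sup>2"
      by (subst norm_fourier_cantor_step) (simp add: power_mult_distrib)
    also have "\<dots> \<le> (cos (2 * pi * \<xi> / 3))\<^sup>2
        * (\<Prod>j<m. (cos (2 * pi * (\<xi> / 3) / 3 ^ (0 + j + 1)))\<^sup>2)"
      by (intro mult_left_mono Suc.IH) simp
    also have "\<dots> = (\<Prod>j<Suc m. (cos (2 * pi * \<xi> / 3 ^ (0 + j + 1)))\<^sup>2)"
      by (simp add: prod.lessThan_Suc_shift mult_ac del: prod.lessThan_Suc)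
    finally show ?case .
  qed
next
  case (Suc q)
  have "norm (fourier_transform cantor_lebesgue \<xi>) \<le> norm (fourier_transform cantor_lebesgue (\<xi> / 3))"
    by (subst norm_fourier_cantor_step) (simp add: mult_left_le_one_le)
  then have "(norm (fourier_transform cantor_lebesgue \<xi>))\<^sup>2
      \<le> (norm (fourier_transform cantor_lebesgue (\<xi> / 3)))\<^sup>2"
    by (intro power_mono) auto
  also note Suc.IH[of "\<xi> / 3"]
  finally show ?case by (simp add: mult_ac)
qed

section \<open>A discrete quadratic mean estimate\<close>

lemma sum_cos_sq_thirds: "(\<Sum>a<3. (cos (t + 2 * pi * real a / 3))\<^sup>2) = 3 / 2"
proof -
  have 1: "cos (2 * pi / 3) = - 1 / 2" "sin (2 * pi / 3) = sqrt 3 / 2"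
    using cos_120 sin_120 by (simp_all add: mult.commute)
  have 2: "2 * pi * 2 / 3 = 2 * pi - 2 * pi / 3" by simp
  have 3: "cos (2 * pi * 2 / 3) = - 1 / 2" "sin (2 * pi * 2 / 3) = - sqrt 3 / 2"
    unfolding 2 cos_diff sin_diff 1 by simp_all
  have expand: "c\<^sup>2 + (c * (- 1 / 2) - s * (r / 2))\<^sup>2 + (c * (- 1 / 2) - s * (- r / 2))\<^sup>2
      = 3 / 2 * c\<^sup>2 + r\<^sup>2 / 2 * s\<^sup>2" for c s r :: real
    by (simp add: power2_eq_square field_simps)
  have "(\<Sum>a<3. (cos (t + 2 * pi * real a / 3))\<^sup>2)
      = (cos t)\<^sup>2 + (cos (t + 2 * pi / 3))\<^sup>2 + (cos (t + 2 * pi * 2 / 3))\<^sup>2"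
    by (simp add: eval_nat_numeral)
  also have "\<dots> = 3 / 2 * (cos t)\<^sup>2 + (sqrt 3)\<^sup>2 / 2 * (sin t)\<^sup>2"
    unfolding cos_add 1 3 by (rule expand)
  also have "\<dots> = 3 / 2 * ((sin t)\<^sup>2 + (cos t)\<^sup>2)"
    by (simp del: sin_cos_squared_add)
  finally show ?thesis by simp
qed

lemma abs_cos_sq_diff_le: "\<bar>(cos a)\<^sup>2 - (cos b)\<^sup>2\<bar> \<le> \<bar>a - b\<bar>" for a b :: real
proof -
  have "(cos a)\<^sup>2 - (cos b)\<^sup>2 = (cos (2 * a) - cos (2 * b)) / 2"
    by (simp add: cos_double_cos)
  moreover have "\<bar>cos (2 * a) - cos (2 * b)\<bar> \<le> norm (cis (2 * a) - cis (2 * b))"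
    using abs_Re_le_cmod[of "cis (2 * a) - cis (2 * b)"] by simp
  ultimately show ?thesis
    using norm_cis_diff_le[of "2 * a" "2 * b"] by simp
qed

text \<open>
  A majorant, for \<open>q \<ge> 4\<close>, of \<open>\<bar>\<phi>\<bar>\<^sup>2\<close> on the whole interval of radius \<open>1\<close> around \<open>x\<close>: the summand \<open>1 / 30\<close> absorbs the
  variation of each factor, and it is small enough for \<open>3 * (1 / 2 + 1 / 30) = 8 / 5\<close> to stay below \<open>2\<close>.
\<close>

definition cos_prod :: "nat \<Rightarrow> nat \<Rightarrow> real \<Rightarrow> real" where
  "cos_prod q m x = (\<Prod>j<m. (cos (2 * pi * x / 3 ^ (q + j + 1)))\<^sup>2 + 1 / 30)"

lemma cos_prod_nonneg: "cos_prod q m x \<ge> 0"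
  unfolding cos_prod_def by (intro prod_nonneg) auto

lemma cos_periodic_nat: "cos (y + 2 * pi * real n) = cos y"
proof -
  have "2 * pi * real n = 2 * real n * pi" by simp
  then show ?thesis by (simp only: cos_add cos_2npi sin_2npi)
qed

lemma cos_prod_periodic: "cos_prod q m (x + real a * 3 ^ (q + m)) = cos_prod q m x"
  unfolding cos_prod_def
proof (rule prod.cong)
  fix j assume "j \<in> {..<m}"
  then have "q + m = (q + j + 1) + (m - (j + 1))" by auto
  then have "(3 :: real) ^ (q + m) = 3 ^ (q + j + 1) * 3 ^ (m - (j + 1))"
    by (metis power_add)
  then have shift: "2 * pi * (x + real a * 3 ^ (q + m)) / 3 ^ (q + j + 1)
      = 2 * pi * x / 3 ^ (q + j + 1) + 2 * pi * real (a * 3 ^ (m - (j + 1)))"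
    by (simp add: field_simps)
  show "(cos (2 * pi * (x + real a * 3 ^ (q + m)) / 3 ^ (q + j + 1)))\<^sup>2 + 1 / 30
      = (cos (2 * pi * x / 3 ^ (q + j + 1)))\<^sup>2 + 1 / 30"
    by (simp only: shift cos_periodic_nat)
qed simp

text \<open>
  Induction on \<open>m\<close>: an index below \<open>3 ^ (q + m + 1)\<close> is an index \<open>i\<close> below the period \<open>3 ^ (q + m)\<close> of the
  first \<open>m\<close> factors plus \<open>a\<close> periods. The new factor alone depends on the leading digit \<open>a\<close>, and the
  three values of \<open>a\<close> shift its angle by thirds of a full turn.
\<close>

lemma sum_cos_prod: "(\<Sum>i<3 ^ (q + m). cos_prod q m (real i + s)) = 3 ^ q * (8 / 5) ^ m"
proof (induction m)
  case 0
  show ?case by (simp add: cos_prod_def)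
next
  case (Suc m)
  let ?p = "3 ^ (q + m) :: nat"
  have last: "cos_prod q (Suc m) (real (i + a * ?p) + s)
      = cos_prod q m (real i + s)
        * ((cos (2 * pi * (real i + s) / 3 ^ (q + m + 1) + 2 * pi * real a / 3))\<^sup>2 + 1 / 30)"
    for i a
  proof -
    have *: "2 * pi * (real (i + a * ?p) + s) / 3 ^ (q + m + 1)
        = 2 * pi * (real i + s) / 3 ^ (q + m + 1) + 2 * pi * real a / 3"
      by (simp add: field_simps)
    have **: "real (i + a * ?p) + s = (real i + s) + real a * 3 ^ (q + m)"
      by simp
    have "cos_prod q (Suc m) (real (i + a * ?p) + s) = cos_prod q m (real (i + a * ?p) + s)
        * ((cos (2 * pi * (real (i + a * ?p) + s) / 3 ^ (q + m + 1)))\<^sup>2 + 1 / 30)"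
      by (simp add: cos_prod_def)
    then show ?thesis unfolding * unfolding ** cos_prod_periodic .
  qed
  have block: "sum g {a * ?p..<a * ?p + ?p} = (\<Sum>i<?p. g (i + a * ?p))" for g :: "nat \<Rightarrow> real" and a
    using sum.shift_bounds_nat_ivl[of g 0 "a * ?p" ?p] by (simp add: add.commute atLeast0LessThan)
  have "(\<Sum>i<3 ^ (q + Suc m). cos_prod q (Suc m) (real i + s))
      = (\<Sum>a<3. \<Sum>i<?p. cos_prod q (Suc m) (real (i + a * ?p) + s))"
    using sum.nat_group[of "\<lambda>i. cos_prod q (Suc m) (real i + s)" ?p 3] unfolding block by simp
  also have "\<dots> = (\<Sum>i<?p. cos_prod q m (real i + s)
      * (\<Sum>a<3. (cos (2 * pi * (real i + s) / 3 ^ (q + m + 1) + 2 * pi * real a / 3))\<^sup>2 + 1 / 30))"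
    unfolding last by (subst sum.swap) (simp add: sum_distrib_left)
  also have "\<dots> = (\<Sum>i<?p. cos_prod q m (real i + s)) * (8 / 5)"
    by (simp only: sum.distrib sum_cos_sq_thirds sum_distrib_right[symmetric]) simp
  finally show ?case by (simp add: Suc.IH)
qed

lemma norm_fourier_cantor_le_cos_prod:
  assumes "q \<ge> 4" "\<bar>\<xi> - x\<bar> \<le> 1"
  shows "(norm (fourier_transform cantor_lebesgue \<xi>))\<^sup>2 \<le> cos_prod q m x"
proof -
  have "(\<Prod>j<m. (cos (2 * pi * \<xi> / 3 ^ (q + j + 1)))\<^sup>2) \<le> cos_prod q m x"
    unfolding cos_prod_def
  proof (rule prod_mono, intro conjI)
    fix j
    \<comment> \<open>The bound \<open>q \<ge> 4\<close> makes every denominator at least \<open>3 ^ 5 = 243\<close>, and \<open>2 * pi / 243 < 1 / 30\<close>.\<close>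
    have "(3 :: real) ^ 5 \<le> 3 ^ (q + j + 1)"
      using assms by (intro power_increasing) auto
    then have big: "30 * (2 * pi) \<le> 3 ^ (q + j + 1)"
      using pi_less_4 by simp
    have "\<bar>(cos (2 * pi * \<xi> / 3 ^ (q + j + 1)))\<^sup>2 - (cos (2 * pi * x / 3 ^ (q + j + 1)))\<^sup>2\<bar>
        \<le> \<bar>2 * pi * \<xi> / 3 ^ (q + j + 1) - 2 * pi * x / 3 ^ (q + j + 1)\<bar>"
      by (rule abs_cos_sq_diff_le)
    also have "\<dots> = 2 * pi * \<bar>\<xi> - x\<bar> / 3 ^ (q + j + 1)"
      by (simp add: abs_mult flip: diff_divide_distrib right_diff_distrib)
    also have "\<dots> \<le> 2 * pi / 3 ^ (q + j + 1)"
      using assms by (intro divide_right_mono) auto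
    also have "\<dots> \<le> 1 / 30"
      using big by (simp add: field_simps)
    finally show "(cos (2 * pi * \<xi> / 3 ^ (q + j + 1)))\<^sup>2
        \<le> (cos (2 * pi * x / 3 ^ (q + j + 1)))\<^sup>2 + 1 / 30"
      by linarith
  qed simp
  with norm_fourier_cantor_le_prod show ?thesis by (rule order_trans)
qed

lemma card_le_diam:
  fixes K :: "nat set"
  assumes "finite K" and diam: "\<And>k l. k \<in> K \<Longrightarrow> l \<in> K \<Longrightarrow> \<bar>real k - real l\<bar> \<le> L" and "L \<ge> 0"
  shows "real (card K) \<le> 1 + L"
proof (cases "K = {}")
  case False
  have "K \<subseteq> {Min K..Max K}" using assms(1) by auto
  then have "card K \<le> card {Min K..Max K}" by (intro card_mono) auto
  moreover have "Min K \<le> Max K"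
    by (rule Min_le[OF assms(1) Max_in[OF assms(1) False]])
  ultimately have "real (card K) \<le> 1 + (real (Max K) - real (Min K))"
    by simp
  moreover have "real (Max K) - real (Min K) \<le> L"
    using diam[of "Max K" "Min K"] assms(1) False by auto
  ultimately show ?thesis by linarith
qed (use assms in auto)

text \<open>
  Each unit cell \<open>[s + i, s + i + 1)\<close> contains at most \<open>1 + 1 / c\<close> of the separated frequencies. The
  majorant at the left end of the cell bounds \<open>\<bar>\<phi>\<bar>\<^sup>2\<close> at each of them, and the cells fill exactly one
  period of the majorant.
\<close>

lemma sum_sq_fourier_cantor_le:
  fixes \<eta> :: "nat \<Rightarrow> real"
  assumes "q \<ge> 4" "c > 0" "finite K"
    and range: "\<And>k. k \<in> K \<Longrightarrow> \<eta> k \<in> {s..<s + 3 ^ (q + m)}"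
    and separated: "\<And>k l. k \<in> K \<Longrightarrow> l \<in> K \<Longrightarrow> c * \<bar>real k - real l\<bar> \<le> \<bar>\<eta> k - \<eta> l\<bar>"
  shows "(\<Sum>k\<in>K. (norm (fourier_transform cantor_lebesgue (\<eta> k)))\<^sup>2)
    \<le> (1 + 1 / c) * (3 ^ q * (8 / 5) ^ m)"
proof -
  define cell where "cell k = nat \<lfloor>\<eta> k - s\<rfloor>" for k
  have cell: "real (cell k) + s \<le> \<eta> k" "\<eta> k < real (cell k) + s + 1" if "k \<in> K" for k
    using range[OF that] by (auto simp: cell_def) linarith+
  have cell_less: "cell ` K \<subseteq> {..<3 ^ (q + m)}"
  proof
    fix i assume "i \<in> cell ` K"
    then obtain k where k: "k \<in> K" "i = cell k" by auto
    have "real i < 3 ^ (q + m)"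
      using cell[OF k(1)] range[OF k(1)] unfolding k(2) atLeastLessThan_iff by linarith
    then show "i \<in> {..<3 ^ (q + m)}" by simp
  qed
  have "(\<Sum>k\<in>K. (norm (fourier_transform cantor_lebesgue (\<eta> k)))\<^sup>2)
      \<le> (\<Sum>k\<in>K. cos_prod q m (real (cell k) + s))"
    using cell \<open>q \<ge> 4\<close>
    by (intro sum_mono norm_fourier_cantor_le_cos_prod) (auto simp: abs_le_iff algebra_simps less_imp_le add.commute)
  also have "\<dots> = (\<Sum>i<3 ^ (q + m). \<Sum>k\<in>{k \<in> K. cell k = i}. cos_prod q m (real (cell k) + s))"
    by (rule sum.group[symmetric]) (use assms cell_less in auto)
  also have "\<dots> = (\<Sum>i<3 ^ (q + m). real (card {k \<in> K. cell k = i}) * cos_prod q m (real i + s))"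
    by (intro sum.cong) auto
  also have "\<dots> \<le> (\<Sum>i<3 ^ (q + m). (1 + 1 / c) * cos_prod q m (real i + s))"
  proof (intro sum_mono mult_right_mono cos_prod_nonneg card_le_diam)
    fix i k l assume "k \<in> {k \<in> K. cell k = i}" "l \<in> {k \<in> K. cell k = i}"
    then have kl: "k \<in> K" "l \<in> K" "cell k = cell l" by auto
    have "c * \<bar>real k - real l\<bar> \<le> 1"
      using separated[OF kl(1,2)] cell[OF kl(1)] cell[OF kl(2)] kl(3) by (auto simp: abs_if split: if_splits)
    then show "\<bar>real k - real l\<bar> \<le> 1 / c"
      using \<open>c > 0\<close> by (simp add: field_simps)
  qed (use assms in auto)
  also have "\<dots> = (1 + 1 / c) * (3 ^ q * (8 / 5) ^ m)"
    by (simp only: sum_distrib_left[symmetric] sum_cos_prod)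
  finally show ?thesis .
qed

section \<open>Linearisation on small pieces\<close>

lemma taylor_first_order_bound:
  fixes F F' F'' :: "real \<Rightarrow> real"
  assumes F: "\<And>x. (F has_real_derivative F' x) (at x)"
    and F': "\<And>x. (F' has_real_derivative F'' x) (at x)"
    and M: "\<And>z. z \<in> {a..a + h} \<Longrightarrow> \<bar>F'' z\<bar> \<le> M" and "h \<ge> 0"
  shows "\<bar>F (a + h) - (F a + F' a * h)\<bar> \<le> M * h\<^sup>2"
proof (cases "h = 0")
  case False
  with \<open>h \<ge> 0\<close> have "a < a + h" by simp
  from MVT2[OF this F] obtain z where z: "a < z" "z < a + h" "F (a + h) - F a = h * F' z" by auto
  from MVT2[OF z(1) F'] obtain w where w: "a < w" "w < z" "F' z - F' a = (z - a) * F'' w" by auto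
  have "F (a + h) - (F a + F' a * h) = h * (F' z - F' a)"
    using z(3) by (simp add: algebra_simps)
  also have "\<bar>\<dots>\<bar> = h * (z - a) * \<bar>F'' w\<bar>"
    unfolding w(3) using z \<open>h \<ge> 0\<close> by (simp add: abs_mult)
  also have "\<dots> \<le> h * h * M"
    using z w M[of w] \<open>h \<ge> 0\<close> by (intro mult_mono) auto
  finally show ?thesis by (simp add: power2_eq_square mult_ac)
qed simp

text \<open>
  After linearising \<open>F\<close> at the left end point of the copy, the integral over the copy is the
  transform \<open>\<phi>\<close> at the frequency \<open>\<eta>\<close>, up to the phase of the end point.
\<close>

lemma norm_piece_le:
  fixes F F' F'' :: "real \<Rightarrow> real"
  assumes F: "\<And>x. (F has_real_derivative F' x) (at x)"
    and F': "\<And>x. (F' has_real_derivative F'' x) (at x)"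
    and M: "\<And>z. z \<in> {0..1} \<Longrightarrow> \<bar>F'' z\<bar> \<le> M" and "k < 3 ^ n"
  shows "norm (\<integral>x. cis (2 * pi * u * F ((real k + x) / 3 ^ n)) \<partial>cantor_lebesgue)
    \<le> norm (fourier_transform cantor_lebesgue (u * F' (real k / 3 ^ n) / 3 ^ n))
      + 2 * pi * M * \<bar>u\<bar> / 9 ^ n"
proof -
  interpret prob_space cantor_lebesgue by (rule prob_space_cantor_lebesgue)
  define a where "a = real k / 3 ^ n"
  define \<eta> where "\<eta> = u * F' a / 3 ^ n"
  define P where "P x = cis (2 * pi * u * F ((real k + x) / 3 ^ n))" for x
  define Q where "Q x = cis (2 * pi * u * F a) * cis (2 * pi * \<eta> * x)" for x
  have "continuous_on UNIV F"
    using F by (intro DERIV_continuous_on) (auto intro: has_field_derivative_at_within)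
  then have [measurable]: "F \<in> borel_measurable borel"
    by (rule borel_measurable_continuous_onI)
  have P: "integrable cantor_lebesgue P" and Q: "integrable cantor_lebesgue Q"
    unfolding P_def Q_def
    by (rule integrable_cantor_lebesgue[of _ 1];
        auto intro!: borel_measurable_cis borel_measurable_times simp: norm_mult)+
  have close: "norm (P x - Q x) \<le> 2 * pi * M * \<bar>u\<bar> / 9 ^ n" if x: "x \<in> {0..1}" for x
  proof -
    have "real k + 1 \<le> 3 ^ n"
      using \<open>k < 3 ^ n\<close> by (metis Suc_leI add.commute of_nat_Suc of_nat_le_iff of_nat_numeral of_nat_power)
    then have a: "0 \<le> a" "a + x / 3 ^ n \<le> 1"
      using x by (auto simp: a_def field_simps)
    have "norm (P x - Q x)
        \<le> \<bar>2 * pi * u * F (a + x / 3 ^ n) - (2 * pi * u * F a + 2 * pi * \<eta> * x)\<bar>"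
      unfolding P_def Q_def cis_mult a_def add_divide_distrib by (rule norm_cis_diff_le)
    also have "\<dots> = \<bar>2 * pi * u * (F (a + x / 3 ^ n) - (F a + F' a * (x / 3 ^ n)))\<bar>"
      by (simp add: \<eta>_def algebra_simps)
    also have "\<dots> = 2 * pi * \<bar>u\<bar> * \<bar>F (a + x / 3 ^ n) - (F a + F' a * (x / 3 ^ n))\<bar>"
      by (simp add: abs_mult)
    also have "\<dots> \<le> 2 * pi * \<bar>u\<bar> * (M * (x / 3 ^ n)\<^sup>2)"
      using a x by (intro mult_left_mono taylor_first_order_bound[OF F F'] M) auto
    also have "\<dots> \<le> 2 * pi * \<bar>u\<bar> * (M * (1 / 3 ^ n)\<^sup>2)"
      using x M[of 0] by (intro mult_left_mono power_mono divide_right_mono) auto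
    also have "\<dots> = 2 * pi * M * \<bar>u\<bar> / 9 ^ n"
      by (simp add: power_divide power2_eq_square mult_ac flip: power_mult_distrib)
    finally show ?thesis .
  qed
  have "norm (\<integral>x. P x \<partial>cantor_lebesgue)
      = norm ((\<integral>x. Q x \<partial>cantor_lebesgue) + (\<integral>x. P x - Q x \<partial>cantor_lebesgue))"
    by (simp add: P Q)
  also have "\<dots> \<le> norm (\<integral>x. Q x \<partial>cantor_lebesgue) + norm (\<integral>x. P x - Q x \<partial>cantor_lebesgue)"
    by (rule norm_triangle_ineq)
  also have "norm (\<integral>x. P x - Q x \<partial>cantor_lebesgue) \<le> (\<integral>x. norm (P x - Q x) \<partial>cantor_lebesgue)"
    by (rule integral_norm_bound)
  also have "\<dots> \<le> 2 * pi * M * \<bar>u\<bar> / 9 ^ n"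
  proof (rule integral_le_const)
    show "AE x in cantor_lebesgue. norm (P x - Q x) \<le> 2 * pi * M * \<bar>u\<bar> / 9 ^ n"
      using cantor_lebesgue_AE by eventually_elim (rule close)
  qed (use P Q in auto)
  also have "(\<integral>x. Q x \<partial>cantor_lebesgue)
      = cis (2 * pi * u * F a) * fourier_transform cantor_lebesgue \<eta>"
    unfolding Q_def fourier_transform_eq_cis by (rule integral_mult_right_zero)
  finally show ?thesis
    by (simp add: P_def \<eta>_def a_def norm_mult)
qed

lemma derivative_gap:
  fixes f f' :: "real \<Rightarrow> real"
  assumes f: "\<And>x. (f has_real_derivative f' x) (at x)"
    and b: "\<And>z. z \<in> {0..1} \<Longrightarrow> b \<le> f' z" and xy: "x \<in> {0..1}" "y \<in> {0..1}"
  shows "b * \<bar>x - y\<bar> \<le> \<bar>f x - f y\<bar>"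
proof -
  have *: "b * (y - x) \<le> \<bar>f x - f y\<bar>" if "x < y" "x \<in> {0..1}" "y \<in> {0..1}" for x y
  proof -
    from MVT2[OF that(1) f] obtain z where "x < z" "z < y" "f y - f x = (y - x) * f' z" by auto
    with b[of z] that have "b * (y - x) \<le> f y - f x" by (simp add: mult.commute mult_right_mono)
    then show ?thesis by linarith
  qed
  then show ?thesis
    using *[of x y] *[of y x] xy by (cases x y rule: linorder_cases) (auto simp: abs_minus_commute)
qed

text \<open>
  The first term is the linearisation error. The second bounds the mean of \<open>\<bar>\<phi>\<bar>\<close> over the frequencies of
  the copies by its quadratic mean. The bound on \<open>q\<close> ensures that these frequencies, of modulus at most
  \<open>9 * 3 ^ n * B\<close>, lie in an interval of length \<open>3 ^ (q + n)\<close> centred at \<open>0\<close>.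
\<close>

lemma norm_fourier_image_le:
  fixes F F' F'' :: "real \<Rightarrow> real"
  assumes F: "\<And>x. (F has_real_derivative F' x) (at x)"
    and F': "\<And>x. (F' has_real_derivative F'' x) (at x)"
    and b: "\<And>z. z \<in> {0..1} \<Longrightarrow> b \<le> F'' z" and "b > 0"
    and M: "\<And>z. z \<in> {0..1} \<Longrightarrow> F'' z \<le> M"
    and B: "\<And>z. z \<in> {0..1} \<Longrightarrow> \<bar>F' z\<bar> \<le> B"
    and q: "q \<ge> 4" "18 * B < 3 ^ q"
    and u: "u \<noteq> 0" "\<bar>u\<bar> \<le> 9 * 9 ^ n"
  shows "norm (fourier_transform (distr cantor_lebesgue borel F) u)
    \<le> 2 * pi * M * (\<bar>u\<bar> / 9 ^ n) + sqrt ((1 + 9 ^ n / (b * \<bar>u\<bar>)) * 3 ^ q * (4 / 5) ^ n)"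
proof -
  define K where "K = cantor_numerators n"
  define \<phi> where "\<phi> \<xi> = norm (fourier_transform cantor_lebesgue \<xi>)" for \<xi>
  define \<eta> where "\<eta> k = u * F' (real k / 3 ^ n) / 3 ^ n" for k :: nat
  define c where "c = b * \<bar>u\<bar> / 9 ^ n"
  have "continuous_on UNIV F"
    using F by (intro DERIV_continuous_on) (auto intro: has_field_derivative_at_within)
  then have [measurable]: "F \<in> borel_measurable borel"
    by (rule borel_measurable_continuous_onI)
  have unit: "real k / 3 ^ n \<in> {0..1}" if "k \<in> K" for k
    using cantor_numerators_less[of k n] that by (simp add: K_def field_simps less_imp_le)
  have "c > 0" using \<open>b > 0\<close> u by (simp add: c_def)
  have nine: "(9 :: real) ^ n = 3 ^ n * 3 ^ n"
    by (simp flip: power_mult_distrib)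
  have "(\<Sum>k\<in>K. (\<phi> (\<eta> k))\<^sup>2) \<le> (1 + 1 / c) * (3 ^ q * (8 / 5) ^ n)"
    unfolding \<phi>_def
  proof (rule sum_sq_fourier_cantor_le[where s = "- (3 ^ (q + n)) / 2"])
    fix k assume k: "k \<in> K"
    have "\<bar>\<eta> k\<bar> = \<bar>u\<bar> * \<bar>F' (real k / 3 ^ n)\<bar> / 3 ^ n"
      by (simp add: \<eta>_def abs_mult)
    also have "\<dots> \<le> (9 * 9 ^ n) * B / 3 ^ n"
      using u B[OF unit[OF k]] by (intro divide_right_mono mult_mono) auto
    also have "\<dots> = 18 * B * 3 ^ n / 2" by (simp add: nine)
    also have "\<dots> < 3 ^ q * 3 ^ n / 2"
      using q by simp
    finally have "\<bar>\<eta> k\<bar> < 3 ^ (q + n) / 2" by (simp add: power_add)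
    then show "\<eta> k \<in> {- (3 ^ (q + n)) / 2..<- (3 ^ (q + n)) / 2 + 3 ^ (q + n)}"
      unfolding atLeastLessThan_iff by linarith
  next
    fix k l assume kl: "k \<in> K" "l \<in> K"
    have "c * \<bar>real k - real l\<bar> = \<bar>u\<bar> / 3 ^ n * (b * \<bar>real k / 3 ^ n - real l / 3 ^ n\<bar>)"
      by (simp add: c_def nine flip: diff_divide_distrib)
    also have "\<dots> \<le> \<bar>u\<bar> / 3 ^ n * \<bar>F' (real k / 3 ^ n) - F' (real l / 3 ^ n)\<bar>"
      by (intro mult_left_mono derivative_gap[OF F' b] unit kl) auto
    also have "\<dots> = \<bar>\<eta> k - \<eta> l\<bar>"
      by (simp add: \<eta>_def abs_mult flip: diff_divide_distrib right_diff_distrib)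
    finally show "c * \<bar>real k - real l\<bar> \<le> \<bar>\<eta> k - \<eta> l\<bar>" .
  qed (use q \<open>c > 0\<close> in \<open>auto simp: K_def finite_cantor_numerators\<close>)
  moreover have "(\<Sum>k\<in>K. \<phi> (\<eta> k))\<^sup>2 \<le> (\<Sum>k\<in>K. (\<phi> (\<eta> k))\<^sup>2) * 2 ^ n"
    using sum_squared_le_sum_of_squares[of "\<lambda>k. \<phi> (\<eta> k)" K]
    by (simp add: K_def card_cantor_numerators)
  ultimately have "(\<Sum>k\<in>K. \<phi> (\<eta> k))\<^sup>2 \<le> (1 + 1 / c) * (3 ^ q * (8 / 5) ^ n) * 2 ^ n"
    by (smt (verit) mult_right_mono zero_le_power)
  also have "\<dots> = (1 + 1 / c) * 3 ^ q * (4 / 5) ^ n * (2 ^ n)\<^sup>2"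
  proof -
    have "(8 / 5 :: real) ^ n = (4 / 5) ^ n * 2 ^ n"
      by (simp flip: power_mult_distrib)
    then show ?thesis by (simp add: power2_eq_square)
  qed
  finally have "((\<Sum>k\<in>K. \<phi> (\<eta> k)) / 2 ^ n)\<^sup>2 \<le> (1 + 1 / c) * 3 ^ q * (4 / 5) ^ n"
    by (simp add: power_divide divide_le_eq)
  then have mean: "(\<Sum>k\<in>K. \<phi> (\<eta> k)) / 2 ^ n \<le> sqrt ((1 + 1 / c) * 3 ^ q * (4 / 5) ^ n)"
    by (rule real_le_rsqrt)
  have abs_M: "\<bar>F'' z\<bar> \<le> M" if "z \<in> {0..1}" for z
    using b[OF that] M[OF that] \<open>b > 0\<close> by simp
  have "fourier_transform (distr cantor_lebesgue borel F) u
      = (\<integral>x. cis (2 * pi * u * F x) \<partial>cantor_lebesgue)"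
    unfolding fourier_transform_eq_cis
    by (rule integral_distr) (auto intro!: borel_measurable_cis)
  also have "\<dots> = (\<Sum>k\<in>K. \<integral>x. cis (2 * pi * u * F ((real k + x) / 3 ^ n)) \<partial>cantor_lebesgue) / 2 ^ n"
    unfolding K_def
    by (rule integral_cantor_lebesgue_pieces[where B = 1]) (auto intro!: borel_measurable_cis)
  also have "norm \<dots> \<le> (\<Sum>k\<in>K. \<phi> (\<eta> k) + 2 * pi * M * \<bar>u\<bar> / 9 ^ n) / 2 ^ n"
    unfolding norm_divide norm_power norm_numeral \<phi>_def \<eta>_def
    by (intro divide_right_mono sum_norm_le norm_piece_le[OF F F' abs_M])
      (auto simp: K_def intro: cantor_numerators_less)
  also have "\<dots> = (\<Sum>k\<in>K. \<phi> (\<eta> k)) / 2 ^ n + 2 * pi * M * (\<bar>u\<bar> / 9 ^ n)"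
    by (simp add: sum.distrib K_def card_cantor_numerators add_divide_distrib)
  also note mean
  finally show ?thesis by (simp add: c_def)
qed

section \<open>Choice of the scale\<close>

text \<open>
  The choice \<open>3 ^ (1.9 * n) \<le> \<bar>u\<bar> \<le> 3 ^ (1.9 * (n + 1))\<close> makes both terms small. Writing \<open>v = 3 ^ (-n / 20)\<close>, the
  ratio \<open>\<bar>u\<bar> / 9 ^ n\<close> is at most \<open>9 * v\<^sup>2\<close>. Under the root, \<open>9 ^ n / \<bar>u\<bar>\<close> is at most \<open>3 ^ (n / 10)\<close> and the factor
  \<open>(4 / 5) ^ n\<close> is at most \<open>3 ^ (-n / 5)\<close>, because \<open>(4 / 5) ^ 5 < 1 / 3\<close>; the root is therefore of order \<open>v\<close>.
  Finally \<open>1.9 * 0.016 < 1 / 20\<close>, so \<open>v\<close> decays faster than \<open>\<bar>u\<bar> powr (-0.016)\<close>.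
\<close>

lemma power_decay_from_scales:
  fixes N :: "real \<Rightarrow> real"
  assumes scale: "\<And>u n. u \<noteq> 0 \<Longrightarrow> \<bar>u\<bar> \<le> 9 * 9 ^ n \<Longrightarrow>
      N u \<le> A * (\<bar>u\<bar> / 9 ^ n) + sqrt ((1 + 9 ^ n / (b * \<bar>u\<bar>)) * D * (4 / 5) ^ n)"
    and trivial: "\<And>u. N u \<le> 1" and "A \<ge> 0" "b > 0" "D \<ge> 0"
  shows "\<exists>C>0. \<forall>u. u \<noteq> 0 \<longrightarrow> N u \<le> C * \<bar>u\<bar> powr (- 0.016)"
proof -
  define E where "E = 9 * A + sqrt ((1 + 1 / b) * D)"
  define C where "C = 3 * E + 1"
  have "E \<ge> 0" using assms by (simp add: E_def)
  have "N u \<le> C * \<bar>u\<bar> powr (- 0.016)" if "u \<noteq> 0" for u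
  proof (cases "\<bar>u\<bar> < 1")
    case True
    then have "1 * 1 \<le> C * \<bar>u\<bar> powr (- 0.016)"
      using \<open>E \<ge> 0\<close> \<open>u \<noteq> 0\<close> by (intro mult_mono) (auto simp: C_def powr_minus_divide powr_le1)
    with trivial[of u] show ?thesis by simp
  next
    case False
    define n where "n = nat \<lfloor>log 3 \<bar>u\<bar> / 1.9\<rfloor>"
    have "log 3 \<bar>u\<bar> \<ge> 0" using False by simp
    then have "real n = of_int \<lfloor>log 3 \<bar>u\<bar> / 1.9\<rfloor>"
      unfolding n_def by (intro of_nat_nat) simp
    then have "real n \<le> log 3 \<bar>u\<bar> / 1.9" "log 3 \<bar>u\<bar> / 1.9 < real n + 1"
      by linarith+
    then have "1.9 * real n \<le> log 3 \<bar>u\<bar>" "log 3 \<bar>u\<bar> \<le> 1.9 * (real n + 1)"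
      by (simp_all add: field_simps)
    then have lower: "3 powr (1.9 * n) \<le> \<bar>u\<bar>" and upper: "\<bar>u\<bar> \<le> 3 powr (1.9 * (n + 1))"
      using le_log_iff[of 3 "\<bar>u\<bar>" "1.9 * n"] log_le_iff[of 3 "\<bar>u\<bar>" "1.9 * (n + 1)"] \<open>u \<noteq> 0\<close>
      by (simp_all add: add.commute)
    define v where "v = (3 :: real) powr (- (n / 20))"
    have v: "0 < v" "v \<le> 1" using powr_mono[of "- (n / 20)" 0 "3 :: real"] by (simp_all add: v_def)
    have v2: "v\<^sup>2 = 3 powr (- (n / 10))"
      by (simp add: v_def power2_eq_square flip: powr_add)
    have nine: "(9 :: real) ^ n = 3 powr (2 * n)"
      using powr_realpow[of 3 "2 * n"] by (simp add: power_mult)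
    have "\<bar>u\<bar> \<le> 3 powr (2 + 2 * n)"
      by (rule order_trans[OF upper]) (simp add: algebra_simps)
    then have admissible: "\<bar>u\<bar> \<le> 9 * 9 ^ n"
      by (simp add: powr_add nine)
    have "\<bar>u\<bar> / 9 ^ n \<le> 3 powr (1.9 * (n + 1)) / 3 powr (2 * n)"
      unfolding nine using upper by (rule divide_right_mono) simp
    also have "\<dots> = 3 powr (1.9 + - (n / 10))"
      by (subst powr_diff[symmetric], rule arg_cong[of _ _ "(powr) 3"]) (simp add: field_simps)
    also have "\<dots> \<le> 9 * v\<^sup>2"
    proof -
      have "(3 :: real) powr 1.9 \<le> 3 powr 2" by (rule powr_mono) auto
      then show ?thesis unfolding powr_add v2 by (intro mult_right_mono) auto
    qed
    also have "\<dots> \<le> 9 * v" using v by (simp add: power2_eq_square mult_left_le)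
    finally have taylor: "\<bar>u\<bar> / 9 ^ n \<le> 9 * v" .
    have "9 ^ n / \<bar>u\<bar> \<le> 3 powr (2 * n) / 3 powr (1.9 * n)"
      unfolding nine using lower \<open>u \<noteq> 0\<close> by (intro divide_left_mono mult_pos_pos) auto
    also have "\<dots> = 3 powr (n / 10)"
      by (subst powr_diff[symmetric], rule arg_cong[of _ _ "(powr) 3"]) (simp add: field_simps)
    finally have "9 ^ n / \<bar>u\<bar> \<le> 3 powr (n / 10)" .
    then have "9 ^ n / \<bar>u\<bar> / b \<le> 3 powr (n / 10) / b"
      using \<open>b > 0\<close> by (intro divide_right_mono) auto
    moreover have "(1 :: real) \<le> 3 powr (n / 10)"
      by (rule ge_one_powr_ge_zero) auto
    ultimately have spacing: "1 + 9 ^ n / (b * \<bar>u\<bar>) \<le> (1 + 1 / b) * 3 powr (n / 10)"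
      by (simp add: algebra_simps)
    have "(4 / 5 :: real) ^ n = (4 / 5) powr (5 * (n / 5))"
      by (simp add: powr_realpow)
    also have "\<dots> = ((4 / 5) powr 5) powr (n / 5)"
      by (simp only: powr_powr)
    also have "\<dots> \<le> (1 / 3) powr (n / 5)"
      by (rule powr_mono2) (auto simp: power_divide)
    also have "\<dots> = 3 powr (- (n / 5))"
      by (simp add: powr_divide powr_minus_divide)
    finally have contraction: "(4 / 5 :: real) ^ n \<le> 3 powr (- (n / 5))" .
    have "(1 + 9 ^ n / (b * \<bar>u\<bar>)) * D * (4 / 5) ^ n
        \<le> ((1 + 1 / b) * 3 powr (n / 10)) * D * 3 powr (- (n / 5))"
      using spacing contraction assms by (intro mult_mono) auto
    also have "\<dots> = (1 + 1 / b) * D * (3 powr (n / 10) * 3 powr (- (n / 5)))"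
      by simp
    also have "\<dots> = (1 + 1 / b) * D * v\<^sup>2"
      unfolding v2 by (simp flip: powr_add)
    finally have "sqrt ((1 + 9 ^ n / (b * \<bar>u\<bar>)) * D * (4 / 5) ^ n) \<le> sqrt ((1 + 1 / b) * D * v\<^sup>2)"
      by (rule real_sqrt_le_mono)
    also have "\<dots> = sqrt ((1 + 1 / b) * D) * v"
      using v by (simp add: real_sqrt_mult)
    finally have "N u \<le> A * (9 * v) + sqrt ((1 + 1 / b) * D) * v"
      using scale[OF \<open>u \<noteq> 0\<close> admissible] mult_left_mono[OF taylor \<open>A \<ge> 0\<close>] by linarith
    also have "\<dots> = E * v" by (simp add: E_def algebra_simps)
    also have "\<dots> \<le> E * (3 * \<bar>u\<bar> powr (- 0.016))"
    proof (intro mult_left_mono \<open>E \<ge> 0\<close>)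
      have "v \<le> 3 powr (1 + (1.9 * (n + 1)) * (- 0.016))"
        unfolding v_def by (rule powr_mono) (auto simp: field_simps)
      also have "\<dots> = 3 * (3 powr (1.9 * (n + 1))) powr (- 0.016)"
        by (simp only: powr_add powr_powr) simp
      also have "\<dots> \<le> 3 * \<bar>u\<bar> powr (- 0.016)"
        using upper \<open>u \<noteq> 0\<close> by (intro mult_left_mono powr_mono2') auto
      finally show "v \<le> 3 * \<bar>u\<bar> powr (- 0.016)" .
    qed
    also have "\<dots> \<le> C * \<bar>u\<bar> powr (- 0.016)"
      by (simp add: C_def algebra_simps)
    finally show ?thesis .
  qed
  moreover have "C > 0" using \<open>E \<ge> 0\<close> by (simp add: C_def)
  ultimately show ?thesis by blast
qed

theorem corollary3p3:
  fixes F F' F'' :: "real \<Rightarrow> real"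
  assumes "\<And>x. (F has_real_derivative F' x) (at x)"
    and "\<And>x. (F' has_real_derivative F'' x) (at x)"
    and "continuous_on UNIV F''"
    and "\<And>x. F'' x > 0"
  shows "\<exists>C>0. \<forall>u::real. u \<noteq> 0 \<longrightarrow>
    norm (fourier_transform (distr cantor_lebesgue borel F) u) \<le> C * \<bar>u\<bar> powr (- 0.016)"
proof -
  have compact: "compact {0..1 :: real}" "{0..1 :: real} \<noteq> {}" by auto
  have "continuous_on {0..1} F''" using assms(3) by (rule continuous_on_subset) simp
  from continuous_attains_inf[OF compact this] continuous_attains_sup[OF compact this]
  obtain x y where x: "\<forall>z\<in>{0..1}. F'' x \<le> F'' z" and y: "\<forall>z\<in>{0..1}. F'' z \<le> F'' y"
    by blast
  have "continuous_on {0..1} F'"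
    using assms(2) by (intro DERIV_continuous_on) (auto intro: has_field_derivative_at_within)
  then have "continuous_on {0..1} (\<lambda>z. \<bar>F' z\<bar>)" by (intro continuous_intros)
  from continuous_attains_sup[OF compact this]
  obtain w where w: "\<forall>z\<in>{0..1}. \<bar>F' z\<bar> \<le> \<bar>F' w\<bar>" by blast
  obtain q0 :: nat where q0: "18 * \<bar>F' w\<bar> < 3 ^ q0"
    using real_arch_pow[of 3 "18 * \<bar>F' w\<bar>"] by auto
  define q where "q = max 4 q0"
  have "(3 :: real) ^ q0 \<le> 3 ^ q" by (rule power_increasing) (auto simp: q_def)
  with q0 have q: "18 * \<bar>F' w\<bar> < 3 ^ q" by linarith
  have "F \<in> borel_measurable borel"
    using assms(1)
    by (intro borel_measurable_continuous_onI DERIV_continuous_on) (auto intro: has_field_derivative_at_within)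
  then have prob: "prob_space (distr cantor_lebesgue borel F)"
    by (intro prob_space.prob_space_distr prob_space_cantor_lebesgue)
      (simp add: measurable_cong_sets[OF sets_cantor_lebesgue refl])
  show ?thesis
  proof (rule power_decay_from_scales)
    fix u :: real and n :: nat assume "u \<noteq> 0" "\<bar>u\<bar> \<le> 9 * 9 ^ n"
    then show "norm (fourier_transform (distr cantor_lebesgue borel F) u)
        \<le> 2 * pi * F'' y * (\<bar>u\<bar> / 9 ^ n)
          + sqrt ((1 + 9 ^ n / (F'' x * \<bar>u\<bar>)) * 3 ^ q * (4 / 5) ^ n)"
      using x y w q assms(4) q_def by (intro norm_fourier_image_le[OF assms(1,2)]) auto
  qed (use assms(4)[THEN less_imp_le] assms(4) norm_fourier_transform_le_1[OF prob] in auto)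
qed

end
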